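(* Let $g\ge 5$ be an integer. Then every positive integer can be written as a sum of three base $g$ palindromes.
   Context: Every nonnegative integer $n$ has a unique base $g$ representation $n=\sum_{j\ge 0}\delta_j g^j$ with digits $0\le\delta_j\le g-1$; if $n$ has $l$ digits, write $n=\delta_{l-1}\cdots\delta_0$ with $\delta_{l-1}\neq 0$. A positive integer $n$ with $l$ base $g$ digits is a base $g$ palindrome if $\delta_{l-i}=\delta_{i-1}$ for all $i=1,\dots,\lfloor l/2\rfloor$. By convention, $0$ is also considered a base $g$ palindrome (so a sum of three palindromes may have some summands equal to $0$). *)

theory Defs
  imports Main
begin

text \<open>
  \<open>base_expansion g n l d\<close>: the natural number \<open>n\<close> has exactly \<open>l\<close> base \<open>g\<close> digits, written
  \<open>n = d (l - 1) \<dots> d 0\<close> with least significant digit \<open>d 0\<close> and nonzero leading digit.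
  The values of \<open>d\<close> at positions \<open>\<ge> l\<close> are irrelevant. \<open>n = 0\<close> has no such expansion.
\<close>

definition base_expansion :: "nat \<Rightarrow> nat \<Rightarrow> nat \<Rightarrow> (nat \<Rightarrow> nat) \<Rightarrow> bool" where
  "base_expansion g n l d \<longleftrightarrow>
     0 < l \<and> (\<forall>j<l. d j < g) \<and> d (l - 1) \<noteq> 0 \<and> n = (\<Sum>j<l. d j * g ^ j)"

text \<open>
  For \<open>g \<ge> 2\<close> and \<open>n > 0\<close>, the length \<open>l\<close> and the digits \<open>d 0, \<dots>, d (l - 1)\<close> are uniquely
  determined, so the existential quantifier below just names them.
  By convention \<open>0\<close> is a palindrome.
\<close>

definition base_palindrome :: "nat \<Rightarrow> nat \<Rightarrow> bool" where
  "base_palindrome g n \<longleftrightarrow>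
     n = 0 \<or> (\<exists>l d. base_expansion g n l d \<and> (\<forall>i\<in>{1..l div 2}. d (l - i) = d (i - 1)))"

end

theory Submission
  imports Defs
begin

text \<open>
  Allow leading zeros and consider sums of three palindromes of prescribed lengths. Fixing the
  outer digits \<open>x, y, z\<close> of the three summands leaves \<open>g\<close> times a sum of the same kind with all
  lengths smaller by two, provided \<open>x + y + z\<close> has the right residue modulo \<open>g\<close>; so \<open>x\<close> and \<open>y\<close> can
  be chosen to steer the remainder into a prescribed interval, and \<open>z\<close> is then forced. The
  interval is long enough to leave two consecutive candidates for \<open>y\<close>, which is used to step over the
  exceptions among the short lengths and to make \<open>z \<noteq> 0\<close> in the last step. By induction on \<open>k\<close> the
  lengths \<open>(k + 2, k + 1, k)\<close> reach almost everything up to about \<open>g ^ (k + 2)\<close>, and the lengths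
  \<open>(k + 3, k + 1, k)\<close>, used with leading digit \<open>1\<close>, continue from there to \<open>2 * g ^ (k + 2)\<close>, where
  the lengths \<open>(k + 3, k + 2, k + 1)\<close> take over. Just above \<open>g ^ 5\<close> two consecutive candidates do not
  suffice when \<open>n mod g = 3\<close>, and lengths \<open>(5, 5, 3)\<close> are used instead.
\<close>

section \<open>Weak palindromes\<close>

text \<open>Numbers with a palindromic expansion of exactly \<open>l\<close> digits, leading zeros allowed.\<close>

fun weak_palindrome :: "nat \<Rightarrow> nat \<Rightarrow> nat \<Rightarrow> bool" where
  "weak_palindrome g 0 m \<longleftrightarrow> m = 0"
| "weak_palindrome g (Suc 0) m \<longleftrightarrow> m < g"
| "weak_palindrome g (Suc (Suc l)) m \<longleftrightarrow>
     (\<exists>x m'. x < g \<and> weak_palindrome g l m' \<and> m = x * (g ^ Suc l + 1) + g * m')"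

text \<open>Bridge between the recursive \<open>weak_palindrome\<close> and
  \<open>base_expansion\<close>: the digits form an explicit function, and only a nonzero leading
  digit is still missing for a palindrome.\<close>

definition symmetric_digits :: "nat \<Rightarrow> nat \<Rightarrow> nat \<Rightarrow> (nat \<Rightarrow> nat) \<Rightarrow> bool" where
  "symmetric_digits g l m d \<longleftrightarrow>
     (\<forall>j<l. d j < g) \<and> (\<forall>j<l. d (l - 1 - j) = d j) \<and> m = (\<Sum>j<l. d j * g ^ j)"

lemma symmetric_digits_wrap:
  assumes d: "symmetric_digits g l m d" and x: "x < g"
  shows "symmetric_digits g (Suc (Suc l)) (x * (g ^ Suc l + 1) + g * m)
           (\<lambda>j. if j = 0 \<or> j = Suc l then x else d (j - 1))"
    (is "symmetric_digits _ _ _ ?e")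
proof -
  have "(\<Sum>j<Suc (Suc l). ?e j * g ^ j) = x + (\<Sum>j<Suc l. ?e (Suc j) * g ^ Suc j)"
    by (subst sum.lessThan_Suc_shift) simp
  also have "\<dots> = x + ((\<Sum>j<l. d j * g ^ Suc j) + x * g ^ Suc l)"
    by simp
  also have "(\<Sum>j<l. d j * g ^ Suc j) = g * m"
    using d by (simp add: symmetric_digits_def sum_distrib_left ac_simps)
  finally have sum: "x * (g ^ Suc l + 1) + g * m = (\<Sum>j<Suc (Suc l). ?e j * g ^ j)"
    by simp
  have bound: "?e j < g" if "j < Suc (Suc l)" for j
    using d x that by (auto simp: symmetric_digits_def less_Suc_eq)
  have sym: "?e (Suc (Suc l) - 1 - j) = ?e j" if "j < Suc (Suc l)" for j
  proof (cases "j = 0 \<or> j = Suc l")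
    case False
    then obtain i where "j = Suc i" "i < l"
      using \<open>j < Suc (Suc l)\<close> by (cases j) auto
    moreover from this have "d (l - Suc i) = d i"
      using d by (simp add: symmetric_digits_def)
    ultimately show ?thesis
      by auto
  qed auto
  show ?thesis
    unfolding symmetric_digits_def using bound sym sum by blast
qed

lemma weak_palindrome_digits:
  assumes "weak_palindrome g l m"
  shows "\<exists>d. symmetric_digits g l m d"
  using assms
proof (induction g l m rule: weak_palindrome.induct)
  case (1 g m)
  then show ?case
    by (simp add: symmetric_digits_def fun_eq_iff)
next
  case (2 g m)
  then show ?case
    by (intro exI[of _ "\<lambda>_. m"]) (simp add: symmetric_digits_def)
next
  case (3 g l m)
  from "3.prems" obtain x m' where "x < g" "weak_palindrome g l m'"
    and m: "m = x * (g ^ Suc l + 1) + g * m'"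
    by auto
  then obtain d where "symmetric_digits g l m' d"
    using "3.IH" by blast
  from symmetric_digits_wrap[OF this \<open>x < g\<close>] show ?case
    unfolding m by blast
qed

lemma base_palindrome_symmetric_digits:
  assumes "symmetric_digits g l m d" "0 < l" "d 0 \<noteq> 0"
  shows "base_palindrome g m"
proof -
  have "d (l - 1) \<noteq> 0"
    using assms by (simp add: symmetric_digits_def)
  moreover have "d (l - i) = d (i - 1)" if "i \<in> {1..l div 2}" for i
  proof -
    have "\<forall>j<l. d (l - 1 - j) = d j"
      using assms(1) by (simp add: symmetric_digits_def)
    moreover have "i - 1 < l" "l - 1 - (i - 1) = l - i"
      using that by auto
    ultimately show ?thesis
      by metis
  qed
  ultimately show ?thesis
    using assms unfolding base_palindrome_def base_expansion_def symmetric_digits_def by blast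
qed

lemma base_palindrome_wrap:
  assumes "weak_palindrome g l m" "0 < x" "x < g"
  shows "base_palindrome g (x * (g ^ Suc l + 1) + g * m)"
proof -
  obtain d where "symmetric_digits g l m d"
    using weak_palindrome_digits assms(1) by blast
  from base_palindrome_symmetric_digits[OF symmetric_digits_wrap[OF this assms(3)]]
  show ?thesis
    using assms(2) by simp
qed

lemma base_palindrome_digit:
  assumes "m < g"
  shows "base_palindrome g m"
proof (cases "m = 0")
  case False
  then show ?thesis
    using assms base_palindrome_symmetric_digits[of g 1 m "\<lambda>_. m"]
    by (simp add: symmetric_digits_def)
qed (simp add: base_palindrome_def)

lemma base_palindrome_two_digits:
  assumes "x < g"
  shows "base_palindrome g (x * (g + 1))"
proof (cases "x = 0")
  case False
  then show ?thesis
    using assms base_palindrome_wrap[of g 0 0 x] by simp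
qed (simp add: base_palindrome_def)

section \<open>Sums of three palindromes, with and without leading zeros\<close>

definition weak_sum :: "nat \<Rightarrow> nat \<Rightarrow> nat \<Rightarrow> nat \<Rightarrow> nat \<Rightarrow> bool" where
  "weak_sum g p q r m \<longleftrightarrow> (\<exists>a b c. weak_palindrome g p a \<and> weak_palindrome g q b \<and>
     weak_palindrome g r c \<and> m = a + b + c)"

definition palindrome_sum :: "nat \<Rightarrow> nat \<Rightarrow> bool" where
  "palindrome_sum g n \<longleftrightarrow> (\<exists>a b c. base_palindrome g a \<and> base_palindrome g b \<and>
     base_palindrome g c \<and> n = a + b + c)"

lemma weak_sumI:
  "\<lbrakk>weak_palindrome g p a; weak_palindrome g q b; weak_palindrome g r c; m = a + b + c\<rbrakk>
    \<Longrightarrow> weak_sum g p q r m"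
  unfolding weak_sum_def by blast

lemma palindrome_sumI:
  "\<lbrakk>base_palindrome g a; base_palindrome g b; base_palindrome g c; n = a + b + c\<rbrakk>
    \<Longrightarrow> palindrome_sum g n"
  unfolding palindrome_sum_def by blast

lemma weak_sum_wrap:
  assumes "weak_sum g p q r m" "x < g" "y < g" "z < g"
    and n: "n = x * (g ^ Suc p + 1) + y * (g ^ Suc q + 1) + z * (g ^ Suc r + 1) + g * m"
  shows "weak_sum g (Suc (Suc p)) (Suc (Suc q)) (Suc (Suc r)) n"
proof -
  obtain a b c where abc: "weak_palindrome g p a" "weak_palindrome g q b" "weak_palindrome g r c"
    and m: "m = a + b + c"
    using assms(1) unfolding weak_sum_def by blast
  have "weak_palindrome g (Suc (Suc l)) (x * (g ^ Suc l + 1) + g * m)"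
    if "weak_palindrome g l m" "x < g" for l x m
    using that by auto
  with abc assms(2-4) show ?thesis
    by (intro weak_sumI[where a = "x * (g ^ Suc p + 1) + g * a"
          and b = "y * (g ^ Suc q + 1) + g * b" and c = "z * (g ^ Suc r + 1) + g * c"])
      (auto simp: n m algebra_simps)
qed

text \<open>Nonzero outer digits make the summands genuine palindromes. If \<open>r = 0\<close>,
  then \<open>c = 0\<close>, so even \<open>z = 0\<close> is allowed: the third summand is then
  \<open>0\<close>.\<close>

lemma palindrome_sum_wrap:
  assumes "weak_sum g p q r m" "0 < x" "x < g" "0 < y" "y < g" "0 < z \<or> r = 0" "z < g"
    and n: "n = x * (g ^ Suc p + 1) + y * (g ^ Suc q + 1) + z * (g ^ Suc r + 1) + g * m"
  shows "palindrome_sum g n"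
proof -
  obtain a b c where abc: "weak_palindrome g p a" "weak_palindrome g q b" "weak_palindrome g r c"
    and m: "m = a + b + c"
    using assms(1) unfolding weak_sum_def by blast
  have "base_palindrome g (z * (g ^ Suc r + 1) + g * c)"
  proof (cases "z = 0")
    case True
    then show ?thesis
      using assms(6) abc(3) by (simp add: base_palindrome_def)
  next
    case False
    then show ?thesis
      using base_palindrome_wrap abc(3) assms(7) by simp
  qed
  with base_palindrome_wrap[OF abc(1) assms(2,3)] base_palindrome_wrap[OF abc(2) assms(4,5)]
  show ?thesis
    by (rule palindrome_sumI) (simp add: n m algebra_simps)
qed

section \<open>Splitting off the outer digits\<close>

text \<open>Modulo \<open>g\<close> the numbers \<open>A + 1\<close>, \<open>B + 1\<close>,
  \<open>C + 1\<close> are all 1, so \<open>z\<close> only has to be the residue of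
  \<open>n - x - y\<close>. Assumption \<open>le\<close> keeps the remainder nonnegative whichever
  digit this is.\<close>

lemma outer_digit_exists:
  fixes g x y n A B C :: nat
  assumes "0 < g" "g dvd A" "g dvd B" "g dvd C"
    and le: "\<And>z. z < g \<Longrightarrow> x * (A + 1) + y * (B + 1) + z * (C + 1) \<le> n"
  obtains z m where "z < g" "n = x * (A + 1) + y * (B + 1) + z * (C + 1) + g * m"
proof -
  define z where "z = nat ((int n - int x - int y) mod int g)"
  have z: "int z = (int n - int x - int y) mod int g" "z < g"
    using assms(1) by (auto simp: z_def nat_less_iff)
  let ?o = "x * (A + 1) + y * (B + 1) + z * (C + 1)"
  have "int g dvd (int n - int x - int y) - int z"
    unfolding z(1) by (simp add: mod_eq_dvd_iff[symmetric])
  moreover have "int g dvd int x * int A + int y * int B + int z * int C"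
    using assms(2-4) by simp
  ultimately have "int g dvd ((int n - int x - int y) - int z)
      - (int x * int A + int y * int B + int z * int C)"
    by (rule dvd_diff)
  also have "\<dots> = int n - int ?o"
    by (simp add: algebra_simps)
  also have "\<dots> = int (n - ?o)"
    using le[OF z(2)] by simp
  finally have "g dvd n - ?o"
    by simp
  then obtain m where "n - ?o = g * m" ..
  with le[OF z(2)] z(2) show thesis
    by (intro that[of z m]) auto
qed

text \<open>Raising the middle digit by one lowers \<open>z\<close> by one modulo \<open>g\<close>.
  As \<open>z - z' - 1\<close> lies between \<open>-g\<close> and \<open>g - 2\<close>, it is
  \<open>0\<close> or \<open>-g\<close>.\<close>

lemma outer_digit_shift:
  fixes g x y z z' A B C m m' :: nat
  assumes "g dvd B" "g dvd C" "z < g" "z' < g"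
    and eq: "x * (A + 1) + y * (B + 1) + z * (C + 1) + g * m
      = x * (A + 1) + (y + 1) * (B + 1) + z' * (C + 1) + g * m'"
  shows "z = z' + 1 \<or> z = 0 \<and> z' + 1 = g"
proof -
  have "int z - int z' - 1 = int B + (int z' - int z) * int C + int g * (int m' - int m)"
    using arg_cong[OF eq, of int] by (simp add: algebra_simps)
  also have "int g dvd \<dots>"
    using assms(1,2) by simp
  finally obtain t where t: "int z - int z' - 1 = int g * t" ..
  have "t < 1"
  proof (rule ccontr)
    assume "\<not> t < 1"
    then have "int g * 1 \<le> int g * t"
      by (intro mult_left_mono) auto
    with t assms(3) show False
      by linarith
  qed
  moreover have "- 2 < t"
  proof (rule ccontr)
    assume "\<not> - 2 < t"
    then have "int g * t \<le> int g * (- 2)"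
      by (intro mult_left_mono) auto
    with t assms(3,4) show False
      by linarith
  qed
  ultimately have "t = 0 \<or> t = - 1"
    by auto
  with t assms(3,4) show ?thesis
    by auto
qed

text \<open>\<open>lower\<close> covers the worst case \<open>y + 1\<close>,
  \<open>z = g - 1\<close> and \<open>upper\<close> the opposite case \<open>y\<close>,
  \<open>z = 0\<close>; hence both remainders land in the same window from \<open>L\<close> to
  \<open>H\<close>.\<close>

lemma two_outer_digits:
  fixes g x y n A B C L H :: nat
  assumes "0 < g" "g dvd A" "g dvd B" "g dvd C"
    and lower: "x * (A + 1) + (y + 1) * (B + 1) + (g - 1) * (C + 1) + L \<le> n"
    and upper: "n \<le> x * (A + 1) + y * (B + 1) + H"
  obtains z m z' m' where "z < g" "z' < g" "z = z' + 1 \<or> z = 0 \<and> z' + 1 = g"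
    "n = x * (A + 1) + y * (B + 1) + z * (C + 1) + g * m"
    "n = x * (A + 1) + (y + 1) * (B + 1) + z' * (C + 1) + g * m'"
    "L \<le> g * m" "g * m \<le> H" "L \<le> g * m'" "g * m' \<le> H"
proof -
  have z_le: "z * (C + 1) \<le> (g - 1) * (C + 1)" if "z < g" for z
    using that by (intro mult_right_mono) auto
  have le: "x * (A + 1) + y * (B + 1) + z * (C + 1) + L \<le> n"
    "x * (A + 1) + (y + 1) * (B + 1) + z * (C + 1) + L \<le> n" if "z < g" for z
    using z_le[OF that] lower by auto
  obtain z m where 1: "z < g" "n = x * (A + 1) + y * (B + 1) + z * (C + 1) + g * m"
    using outer_digit_exists[OF assms(1-4), of x y n] le(1) by (metis add_leD1)
  obtain z' m' where 2: "z' < g" "n = x * (A + 1) + (y + 1) * (B + 1) + z' * (C + 1) + g * m'"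
    using outer_digit_exists[OF assms(1-4), of x "y + 1" n] le(2) by (metis add_leD1)
  have "z = z' + 1 \<or> z = 0 \<and> z' + 1 = g"
    using outer_digit_shift[OF assms(3,4) 1(1) 2(1)] 1(2) 2(2) by metis
  moreover have "L \<le> g * m" "g * m \<le> H"
    using le(1)[OF 1(1)] upper 1(2) by linarith+
  moreover have "L \<le> g * m'" "g * m' \<le> H"
    using le(2)[OF 2(1)] upper 2(2) by (simp_all add: algebra_simps)
  ultimately show thesis
    using that 1 2 by blast
qed

text \<open>
  Two consecutive values \<open>y, y + 1\<close> of the middle outer digit leave remainders \<open>m, m'\<close>
  related as below. For the shortest lengths some numbers are not weak sums, but this never
  happens to both \<open>m\<close> and \<open>m'\<close>.
\<close>

definition nearly_full :: "nat \<Rightarrow> nat \<Rightarrow> nat \<Rightarrow> nat \<Rightarrow> nat \<Rightarrow> nat \<Rightarrow> bool" where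
  "nearly_full g p q r lo hi \<longleftrightarrow> (\<forall>z z' m m'. (z = z' + 1 \<or> z = 0 \<and> z' + 1 = g)
     \<and> z * (g ^ Suc r + 1) + g * m = (g ^ Suc q + 1) + z' * (g ^ Suc r + 1) + g * m'
     \<and> m \<in> {lo..hi} \<and> m' \<in> {lo..hi} \<longrightarrow> weak_sum g p q r m \<or> weak_sum g p q r m')"

definition full :: "nat \<Rightarrow> nat \<Rightarrow> nat \<Rightarrow> nat \<Rightarrow> nat \<Rightarrow> nat \<Rightarrow> bool" where
  "full g p q r lo hi \<longleftrightarrow> (\<forall>m\<in>{lo..hi}. weak_sum g p q r m)"

lemma full_imp_nearly_full: "full g p q r lo hi \<Longrightarrow> nearly_full g p q r lo hi"
  unfolding full_def nearly_full_def by blast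

lemma nearly_fullD:
  assumes "nearly_full g p q r lo hi" "z = z' + 1 \<or> z = 0 \<and> z' + 1 = g"
    "n = c + y * (g ^ Suc q + 1) + z * (g ^ Suc r + 1) + g * m"
    "n = c + (y + 1) * (g ^ Suc q + 1) + z' * (g ^ Suc r + 1) + g * m'"
    "m \<in> {lo..hi}" "m' \<in> {lo..hi}"
  shows "weak_sum g p q r m \<or> weak_sum g p q r m'"
proof -
  have "z * (g ^ Suc r + 1) + g * m = (g ^ Suc q + 1) + z' * (g ^ Suc r + 1) + g * m'"
    using assms(3,4) by (simp add: distrib_right)
  then show ?thesis
    using assms(1,2,5,6) unfolding nearly_full_def by blast
qed

lemma weak_sum_nearly_full:
  assumes nf: "nearly_full g p q r lo hi" and "x < g" "y + 1 < g"
    and lower: "x * (g ^ Suc p + 1) + (y + 1) * (g ^ Suc q + 1) + (g - 1) * (g ^ Suc r + 1)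
        + g * lo \<le> n"
    and upper: "n \<le> x * (g ^ Suc p + 1) + y * (g ^ Suc q + 1) + g * hi"
  shows "weak_sum g (Suc (Suc p)) (Suc (Suc q)) (Suc (Suc r)) n"
proof -
  have "0 < g" "g dvd g ^ Suc p" "g dvd g ^ Suc q" "g dvd g ^ Suc r"
    using assms(2) by auto
  from two_outer_digits[OF this lower upper] obtain z m z' m' where z: "z < g" "z' < g"
    "z = z' + 1 \<or> z = 0 \<and> z' + 1 = g"
    and n: "n = x * (g ^ Suc p + 1) + y * (g ^ Suc q + 1) + z * (g ^ Suc r + 1) + g * m"
      "n = x * (g ^ Suc p + 1) + (y + 1) * (g ^ Suc q + 1) + z' * (g ^ Suc r + 1) + g * m'"
    and "g * lo \<le> g * m" "g * m \<le> g * hi" "g * lo \<le> g * m'" "g * m' \<le> g * hi" .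
  then have "m \<in> {lo..hi}" "m' \<in> {lo..hi}"
    using \<open>0 < g\<close> by auto
  from nearly_fullD[OF nf z(3) n this] show ?thesis
  proof
    assume "weak_sum g p q r m"
    from weak_sum_wrap[OF this _ _ _ n(1)] show ?thesis
      using z assms(2,3) by linarith
  next
    assume "weak_sum g p q r m'"
    from weak_sum_wrap[OF this _ _ _ n(2)] show ?thesis
      using z assms(2,3) by linarith
  qed
qed

text \<open>The digits \<open>z\<close> and \<open>z'\<close> are never both zero. If the range is
  \<open>full\<close>, the choice between them is free to secure a nonzero digit; if it is only
  \<open>nearly_full\<close>, the choice is spent on the remainder, and \<open>r = 0\<close> makes a
  zero digit harmless.\<close>

lemma palindrome_sum_nearly_full:
  assumes nf: "r = 0 \<and> nearly_full g p q r lo hi \<or> full g p q r lo hi"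
    and "0 < x" "x < g" "0 < y" "y + 1 < g"
    and lower: "x * (g ^ Suc p + 1) + (y + 1) * (g ^ Suc q + 1) + (g - 1) * (g ^ Suc r + 1)
        + g * lo \<le> n"
    and upper: "n \<le> x * (g ^ Suc p + 1) + y * (g ^ Suc q + 1) + g * hi"
  shows "palindrome_sum g n"
proof -
  have "0 < g" "g dvd g ^ Suc p" "g dvd g ^ Suc q" "g dvd g ^ Suc r"
    using assms(3) by auto
  from two_outer_digits[OF this lower upper] obtain z m z' m' where z: "z < g" "z' < g"
    "z = z' + 1 \<or> z = 0 \<and> z' + 1 = g"
    and n: "n = x * (g ^ Suc p + 1) + y * (g ^ Suc q + 1) + z * (g ^ Suc r + 1) + g * m"
      "n = x * (g ^ Suc p + 1) + (y + 1) * (g ^ Suc q + 1) + z' * (g ^ Suc r + 1) + g * m'"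
    and "g * lo \<le> g * m" "g * m \<le> g * hi" "g * lo \<le> g * m'" "g * m' \<le> g * hi" .
  then have m: "m \<in> {lo..hi}" "m' \<in> {lo..hi}"
    using \<open>0 < g\<close> by auto
  have "(0 < z \<or> r = 0) \<and> weak_sum g p q r m \<or> (0 < z' \<or> r = 0) \<and> weak_sum g p q r m'"
    using nf
  proof
    assume "full g p q r lo hi"
    then show ?thesis
      using m z(3) assms(5) unfolding full_def by auto
  qed (use nearly_fullD[OF _ z(3) n m] in auto)
  then consider "0 < z \<or> r = 0" "weak_sum g p q r m" | "0 < z' \<or> r = 0" "weak_sum g p q r m'"
    by blast
  then show ?thesis
  proof cases
    case 1
    from palindrome_sum_wrap[OF 1(2) _ _ _ _ 1(1) _ n(1)] show ?thesis
      using z assms(2-5) by linarith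
  next
    case 2
    from palindrome_sum_wrap[OF 2(2) _ _ _ _ 2(1) _ n(2)] show ?thesis
      using z assms(2-5) by linarith
  qed
qed

text \<open>Windows from \<open>a * s + L\<close> to \<open>a * s + H\<close> leave no gap when the
  step \<open>s\<close> is at most the number of integers in a window.\<close>

lemma staircase:
  fixes L H s n k :: nat
  assumes "L \<le> n" "n \<le> k * s + H" "L + s \<le> H + 1"
  shows "\<exists>a\<le>k. a * s + L \<le> n \<and> n \<le> a * s + H"
  using assms(2)
proof (induction k)
  case (Suc k)
  show ?case
  proof (cases "n \<le> k * s + H")
    case True
    then show ?thesis
      using Suc.IH le_SucI by blast
  next
    case False
    then have "Suc k * s + L \<le> n"
      using assms(3) by simp
    then show ?thesis
      using Suc.prems by blast
  qed
qed (use assms(1) in simp)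

text \<open>Two nested staircases: assumption \<open>T\<close> closes the gaps between successive
  \<open>y\<close>, assumption \<open>S\<close> those between the resulting blocks for successive
  \<open>x\<close>. A window starts at \<open>y + 1\<close> but ends according to \<open>y\<close>,
  because both digits must be usable. The digits start at \<open>e\<close>, which is 0 for weak sums
  and 1 for leading digits.\<close>

lemma two_staircases:
  fixes g S T L H n e :: nat
  assumes "e * S + (e + 1) * T + L \<le> n" "n \<le> (g - 1) * S + (g - 2) * T + H"
    and T: "L + 2 * T \<le> H + 1" and S: "S + (e + 1) * T + L \<le> (g - 2) * T + H + 1"
    and "e + 2 \<le> g"
  obtains x y where "e \<le> x" "x < g" "e \<le> y" "y + 1 < g"
    "x * S + (y + 1) * T + L \<le> n" "n \<le> x * S + y * T + H"
proof -
  \<comment> \<open>The coarse staircase: for fixed \<open>x = a + e\<close> the windows for all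
    \<open>y\<close> from \<open>e\<close> to \<open>g - 2\<close> merge into one.\<close>
  have "\<exists>a\<le>g - 1 - e. a * S + (e * S + (e + 1) * T + L) \<le> n
      \<and> n \<le> a * S + (e * S + ((g - 2) * T + H))"
  proof (rule staircase)
    have "(g - 1 - e) * S + e * S = (g - 1) * S"
      using assms(5) by (simp flip: distrib_right)
    then show "n \<le> (g - 1 - e) * S + (e * S + ((g - 2) * T + H))"
      using assms(2) by linarith
  qed (use assms in auto)
  then obtain a where a: "a \<le> g - 1 - e" "a * S + (e * S + (e + 1) * T + L) \<le> n"
    "n \<le> a * S + (e * S + ((g - 2) * T + H))"
    by blast
  define n' where "n' = n - (a + e) * S"
  have n: "n = (a + e) * S + n'"
    using a(2) by (simp add: n'_def distrib_right)
  have "\<exists>b\<le>g - 2 - e. b * T + ((e + 1) * T + L) \<le> n' \<and> n' \<le> b * T + (e * T + H)"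
  proof (rule staircase)
    have "(g - 2 - e) * T + e * T = (g - 2) * T"
      using assms(5) by (simp flip: distrib_right)
    then show "n' \<le> (g - 2 - e) * T + (e * T + H)"
      using a(3) n by (simp add: distrib_right)
  qed (use a(2) n T in \<open>auto simp: distrib_right\<close>)
  then obtain b where "b \<le> g - 2 - e" "b * T + ((e + 1) * T + L) \<le> n'" "n' \<le> b * T + (e * T + H)"
    by blast
  then show thesis
    using a(1) n assms(5) by (intro that[of "a + e" "b + e"]) (auto simp: algebra_simps)
qed

section \<open>The shortest lengths\<close>

lemma weak_palindrome_2: "x < g \<Longrightarrow> weak_palindrome g 2 (x * (g + 1))"
  by (auto simp: numeral_2_eq_2)

lemma weak_palindrome_3: "\<lbrakk>x < g; y < g\<rbrakk> \<Longrightarrow> weak_palindrome g 3 (x * (g ^ 2 + 1) + g * y)"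
  by (auto simp: numeral_3_eq_3 numeral_2_eq_2)

lemma weak_palindrome_4:
  assumes "x < g" "y < g"
  shows "weak_palindrome g 4 (x * (g ^ 3 + 1) + g * (y * (g + 1)))"
proof -
  have "weak_palindrome g (Suc (Suc 2)) (x * (g ^ Suc 2 + 1) + g * (y * (g + 1)))"
    using weak_palindrome_2[OF assms(2)] assms(1) weak_palindrome.simps(3) by blast
  then show ?thesis
    by (simp add: eval_nat_numeral)
qed

text \<open>Division by \<open>g + 1\<close> yields a two-digit palindrome and a remainder, which is
  a digit unless it equals \<open>g\<close>.\<close>

lemma weak_sum_2_1_0:
  assumes "m < g * (g + 1)" "m mod (g + 1) \<noteq> g"
  shows "weak_sum g 2 1 0 m"
proof (rule weak_sumI)
  have "m mod (g + 1) < g + 1"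
    by (intro mod_less_divisor) simp
  with assms(2) have "m mod (g + 1) < g"
    by linarith
  then show "weak_palindrome g 1 (m mod (g + 1))"
    by simp
  show "weak_palindrome g 2 (m div (g + 1) * (g + 1))"
    using assms(1) by (intro weak_palindrome_2 less_mult_imp_div_less)
  show "weak_palindrome g 0 0"
    by simp
qed (simp only: add_0_right div_mult_mod_eq)

lemma weak_sum_3_1_0:
  assumes "m < g * (g\<^sup>2 + 1)" "m mod (g\<^sup>2 + 1) \<noteq> g\<^sup>2"
  shows "weak_sum g 3 1 0 m"
proof (rule weak_sumI)
  let ?r = "m mod (g\<^sup>2 + 1)"
  have "0 < g"
    using assms(1) by (cases g) auto
  have "?r < g\<^sup>2 + 1"
    by (intro mod_less_divisor) simp
  with assms(2) have "?r < g * g"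
    unfolding power2_eq_square by linarith
  then have "?r div g < g"
    by (rule less_mult_imp_div_less)
  with less_mult_imp_div_less[OF assms(1)]
  show "weak_palindrome g 3 (m div (g\<^sup>2 + 1) * (g\<^sup>2 + 1) + g * (?r div g))"
    by (rule weak_palindrome_3)
  show "weak_palindrome g 1 (?r mod g)"
    using \<open>0 < g\<close> by simp
  show "weak_palindrome g 0 0"
    by simp
  have "m = m div (g\<^sup>2 + 1) * (g\<^sup>2 + 1) + ?r" "?r = g * (?r div g) + ?r mod g"
    by (simp_all only: div_mult_mod_eq mult_div_mod_eq)
  then show "m = m div (g\<^sup>2 + 1) * (g\<^sup>2 + 1) + g * (?r div g) + ?r mod g + 0"
    by linarith
qed

text \<open>The bound \<open>2 * g^2 - 2\<close> is the value for \<open>a = y = z = g - 1\<close>.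
  For a given \<open>a\<close>, division of the rest by \<open>g + 1\<close> fails only at residue
  \<open>g\<close>; since \<open>g\<close> is -1 modulo \<open>g + 1\<close>, changing
  \<open>a\<close> by one avoids it. Small \<open>n\<close> use \<open>a\<close> in {0, 1}, large
  \<open>n\<close> use \<open>a\<close> in {g - 2, g - 1}.\<close>

lemma three_digit_sum:
  fixes g n :: nat
  assumes "2 \<le> g" "n + 2 \<le> 2 * g\<^sup>2"
  shows "\<exists>a y z. a < g \<and> y < g \<and> z < g \<and> n = g * a + y * (g + 1) + z"
proof -
  have hit: ?thesis if "a < g" "n = g * a + r" "r < g * (g + 1)" "r mod (g + 1) \<noteq> g" for a r
  proof (rule exI[of _ a], rule exI[of _ "r div (g + 1)"], rule exI[of _ "r mod (g + 1)"],
      intro conjI)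
    have "r mod (g + 1) < g + 1"
      by (intro mod_less_divisor) simp
    then show "r mod (g + 1) < g"
      using that(4) by linarith
    show "r div (g + 1) < g"
      using that(3) by (rule less_mult_imp_div_less)
    have "r = r div (g + 1) * (g + 1) + r mod (g + 1)"
      by (simp only: div_mult_mod_eq)
    then show "n = g * a + r div (g + 1) * (g + 1) + r mod (g + 1)"
      using that(2) by linarith
  qed (use that in simp)
  \<comment> \<open>Removes truncated subtraction: \<open>g - 1\<close> becomes \<open>h + 1\<close>
    and \<open>g - 2\<close> becomes \<open>h\<close>.\<close>
  obtain h where h: "g = h + 2"
    using assms(1) by (metis le_add_diff_inverse2)
  show ?thesis
  proof (cases "n < g * (g + 1)")
    case True
    show ?thesis
    proof (cases "n mod (g + 1) = g")
      case True
      define j where "j = n div (g + 1)"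
      have "n = j * (g + 1) + g"
        using div_mult_mod_eq[of n "g + 1"] True by (simp add: j_def)
      moreover have "j * (g + 1) mod (g + 1) = 0"
        by (rule mod_mult_self2_is_0)
      ultimately show ?thesis
        using \<open>n < g * (g + 1)\<close> h by (intro hit[of 1 "j * (g + 1)"]) auto
    qed (use True h in \<open>intro hit[of 0 n], auto\<close>)
  next
    case False
    define r where "r = n - g * (h + 1)"
    have n: "n = g * (h + 1) + r"
      using False h by (simp add: r_def)
    have r: "r + 2 \<le> g * (g + 1)"
      using assms(2) n h by (simp add: algebra_simps power2_eq_square)
    show ?thesis
    proof (cases "r mod (g + 1) = g")
      case True
      define j where "j = r div (g + 1)"
      \<comment> \<open>Lowering \<open>a\<close> to \<open>h\<close> adds \<open>g\<close> to the
        rest, which becomes \<open>(j + 1) * (g + 1) + (h + 1)\<close>; \<open>j < h + 1\<close>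
        keeps it in range.\<close>
      have j: "r = j * (g + 1) + g"
        using div_mult_mod_eq[of r "g + 1"] True by (simp add: j_def)
      have "j < h + 1"
      proof (rule ccontr)
        assume "\<not> j < h + 1"
        then have "(h + 1) * (g + 1) \<le> j * (g + 1)"
          by (intro mult_right_mono) auto
        with r j h show False
          by (simp add: algebra_simps)
      qed
      then have "(j + 1) * (g + 1) \<le> (h + 1) * (g + 1)"
        by (intro mult_right_mono) auto
      then have "(j + 1) * (g + 1) + (h + 1) < g * (g + 1)"
        using h by (simp add: algebra_simps)
      moreover have "n = g * h + ((j + 1) * (g + 1) + (h + 1))"
        using n j h by (simp add: algebra_simps)
      moreover have "((j + 1) * (g + 1) + (h + 1)) mod (g + 1) = (h + 1) mod (g + 1)"
        by (rule mod_mult_self3)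
      ultimately show ?thesis
        using h by (intro hit[of h "(j + 1) * (g + 1) + (h + 1)"]) auto
    qed (use n r h in \<open>intro hit[of "h + 1" r], auto\<close>)
  qed
qed

text \<open>Split off \<open>x\<close> by division by \<open>g^2 + 1\<close>, capped at
  \<open>g - 1\<close>, and leave the rest to \<open>three_digit_sum\<close>; the bound is again the
  largest possible value. The last conjunct later provides a nonzero leading digit.\<close>

lemma digits_of_lengths_3_2_1:
  fixes g m :: nat
  assumes "2 \<le> g" "m + 3 \<le> g ^ 3 + g\<^sup>2 + g"
  shows "\<exists>x a y z. x < g \<and> a < g \<and> y < g \<and> z < g
    \<and> m = x * (g\<^sup>2 + 1) + g * a + y * (g + 1) + z \<and> (g\<^sup>2 < m \<longrightarrow> 0 < x)"
proof -
  obtain h where h: "g = h + 2"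
    using assms(1) by (metis le_add_diff_inverse2)
  have "\<exists>x<g. \<exists>n. m = x * (g\<^sup>2 + 1) + n \<and> n + 2 \<le> 2 * g\<^sup>2
      \<and> (g\<^sup>2 < m \<longrightarrow> 0 < x)"
  proof (cases "m < g * (g\<^sup>2 + 1)")
    case True
    have "m mod (g\<^sup>2 + 1) < g\<^sup>2 + 1"
      by (intro mod_less_divisor) simp
    moreover have "3 \<le> g\<^sup>2"
      using h by (simp add: algebra_simps power2_eq_square)
    ultimately have "m mod (g\<^sup>2 + 1) + 2 \<le> 2 * g\<^sup>2"
      by linarith
    moreover have "m div (g\<^sup>2 + 1) < g"
      using True by (rule less_mult_imp_div_less)
    moreover have "m = m div (g\<^sup>2 + 1) * (g\<^sup>2 + 1) + m mod (g\<^sup>2 + 1)"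
      by (simp only: div_mult_mod_eq)
    moreover have "g\<^sup>2 < m \<longrightarrow> 0 < m div (g\<^sup>2 + 1)"
      by (simp add: div_greater_zero_iff)
    ultimately show ?thesis
      by blast
  next
    case False
    define n where "n = m - (h + 1) * (g\<^sup>2 + 1)"
    have "m = (h + 1) * (g\<^sup>2 + 1) + n"
      using False h by (simp add: n_def)
    moreover from this have "n + 2 \<le> 2 * g\<^sup>2"
      using assms(2) h by (simp add: algebra_simps power2_eq_square power3_eq_cube)
    ultimately show ?thesis
      using h by (intro exI[of _ "h + 1"]) auto
  qed
  then obtain x n where x: "x < g" "m = x * (g\<^sup>2 + 1) + n" "n + 2 \<le> 2 * g\<^sup>2" "g\<^sup>2 < m \<longrightarrow> 0 < x"
    by blast
  from three_digit_sum[OF assms(1) x(3)] obtain a y z where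
    "a < g" "y < g" "z < g" "n = g * a + y * (g + 1) + z"
    by blast
  moreover from this x(2) have "m = x * (g\<^sup>2 + 1) + g * a + y * (g + 1) + z"
    by simp
  ultimately show ?thesis
    using x(1,4) by blast
qed

lemma weak_sum_3_2_1:
  assumes "2 \<le> g" "m + 3 \<le> g ^ 3 + g\<^sup>2 + g"
  shows "weak_sum g 3 2 1 m"
proof -
  obtain x a y z where "x < g" "a < g" "y < g" "z < g"
    "m = x * (g\<^sup>2 + 1) + g * a + y * (g + 1) + z"
    using digits_of_lengths_3_2_1[OF assms] by blast
  then show ?thesis
    using weak_palindrome_3[of x g a] weak_palindrome_2[of y g]
    by (intro weak_sumI[of g 3 "x * (g\<^sup>2 + 1) + g * a" 2 "y * (g + 1)" 1 z]) auto
qed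

text \<open>Since \<open>g + 1\<close> divides \<open>g^3 + 1\<close>, all palindromes of lengths 4
  and 2 are multiples of \<open>g + 1\<close>, so the single digit must be
  \<open>m mod (g + 1)\<close>. The remaining quotient is below \<open>g^2\<close>, and its two
  digits \<open>a\<close>, \<open>b\<close> become the inner digit of length 4 and the digit of
  length 2.\<close>

lemma weak_sum_4_2_1:
  assumes "m < g * (g ^ 3 + 1)" "m mod (g + 1) \<noteq> g"
  shows "weak_sum g 4 2 1 m"
proof -
  define x r where "x = m div (g ^ 3 + 1)" and "r = m mod (g ^ 3 + 1)"
  have m: "m = x * (g ^ 3 + 1) + r"
    unfolding x_def r_def by (simp only: div_mult_mod_eq)
  have "x < g"
    unfolding x_def using assms(1) by (rule less_mult_imp_div_less)
  have "0 < g"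
    using assms(1) by (cases g) auto
  have r: "r \<le> g ^ 3"
    unfolding r_def using mod_less_divisor[of "g ^ 3 + 1" m] by simp
  have "int (g ^ 3 + 1) = int (g + 1) * (int g ^ 2 - int g + 1)"
    by (simp add: algebra_simps power2_eq_square power3_eq_cube)
  then have "int (g + 1) dvd int (g ^ 3 + 1)"
    by (metis dvd_triv_left)
  then have "g + 1 dvd g ^ 3 + 1"
    by (simp only: int_dvd_int_iff)
  then have "g + 1 dvd x * (g ^ 3 + 1)"
    by (rule dvd_mult)
  then have "m mod (g + 1) = r mod (g + 1)"
    unfolding m by (metis add.commute mod_add_self2 dvd_def mod_mult_self2)
  moreover have "r mod (g + 1) < g + 1"
    by (intro mod_less_divisor) simp
  ultimately have z: "r mod (g + 1) < g"
    using assms(2) by linarith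
  define q where "q = r div (g + 1)"
  have "q * (g + 1) \<le> r"
    unfolding q_def by (rule div_times_less_eq_dividend)
  also note r
  also have "g ^ 3 < g * g * (g + 1)"
    using \<open>0 < g\<close> by (simp add: power3_eq_cube)
  finally have "q < g * g"
    by (simp only: mult_less_cancel2)
  then have "q div g < g"
    by (rule less_mult_imp_div_less)
  then obtain a b where q: "q = a * g + b" "a < g" "b < g"
    using \<open>0 < g\<close> by (metis div_mult_mod_eq mod_less_divisor)
  moreover have "r = q * (g + 1) + r mod (g + 1)"
    unfolding q_def by (simp only: div_mult_mod_eq)
  ultimately show ?thesis
    using weak_palindrome_4[OF \<open>x < g\<close> q(2)] weak_palindrome_2[OF q(3)] z
    by (intro weak_sumI[of g 4 "x * (g ^ 3 + 1) + g * (a * (g + 1))" 2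
          "b * (g + 1)" 1 "r mod (g + 1)"]) (auto simp: m algebra_simps)
qed

text \<open>If only one residue modulo \<open>c\<close> is exceptional, it suffices that
  \<open>m\<close> and \<open>m'\<close> are incongruent. Their difference is \<open>d\<close> when
  \<open>z = z' + 1\<close>, and \<open>d + g ^ Suc r + 1\<close> when the digit wraps
  around.\<close>

lemma nearly_full_residue:
  assumes ws: "\<And>m. \<lbrakk>m \<le> hi; m mod c \<noteq> b\<rbrakk> \<Longrightarrow> weak_sum g p q r m"
    and d: "g ^ q = g ^ r + d" and not_dvd: "\<not> c dvd d" "\<not> c dvd d + g ^ Suc r + 1" and "0 < g"
  shows "nearly_full g p q r lo hi"
  unfolding nearly_full_def
proof (intro allI impI, elim conjE)
  fix z z' m m'
  assume z: "z = z' + 1 \<or> z = 0 \<and> z' + 1 = g"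
    and eq: "z * (g ^ Suc r + 1) + g * m = (g ^ Suc q + 1) + z' * (g ^ Suc r + 1) + g * m'"
    and hi: "m \<in> {lo..hi}" "m' \<in> {lo..hi}"
  have "m = m' + d \<or> m = m' + (d + g ^ Suc r + 1)"
    using z
  proof
    assume "z = z' + 1"
    with eq d have "g * m = g * (m' + d)"
      by (simp add: algebra_simps)
    then show ?thesis
      using \<open>0 < g\<close> by (auto simp only: nat_mult_eq_cancel1)
  next
    assume "z = 0 \<and> z' + 1 = g"
    then have "z = 0" "g = z' + 1"
      by auto
    with eq d have "g * m = g * (m' + (d + g ^ Suc r + 1))"
      by (simp add: algebra_simps)
    then show ?thesis
      using \<open>0 < g\<close> by (auto simp only: nat_mult_eq_cancel1)
  qed
  then have "m mod c \<noteq> m' mod c"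
    using not_dvd by (auto simp: mod_eq_dvd_iff_nat add.assoc)
  then show "weak_sum g p q r m \<or> weak_sum g p q r m'"
    using ws hi by (metis atLeastAtMost_iff)
qed

text \<open>The differences \<open>g - 1\<close> and \<open>2 * g\<close> are both -2 modulo
  \<open>g + 1\<close>.\<close>

lemma nearly_full_2_1_0:
  assumes "5 \<le> g"
  shows "nearly_full g 2 1 0 lo (g\<^sup>2 + 3)"
proof (rule nearly_full_residue)
  fix m
  assume "m \<le> g\<^sup>2 + 3" "m mod (g + 1) \<noteq> g"
  moreover have "g\<^sup>2 + 3 < g * (g + 1)"
    using assms by (simp add: power2_eq_square)
  ultimately show "weak_sum g 2 1 0 m"
    by (intro weak_sum_2_1_0) auto
next
  show "\<not> g + 1 dvd g - 1"
    using assms by (intro nat_dvd_not_less) auto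
  have "(g - 1) + g ^ Suc 0 + 1 = (g + 1) + (g - 1)"
    using assms by simp
  then show "\<not> g + 1 dvd (g - 1) + g ^ Suc 0 + 1"
    using \<open>\<not> g + 1 dvd g - 1\<close> by (simp only: dvd_add_triv_left_iff) simp
qed (use assms in auto)

text \<open>The differences \<open>g - 1\<close> and \<open>2 * g\<close> are positive and smaller
  than the modulus \<open>g^2 + 1\<close>.\<close>

lemma nearly_full_3_1_0:
  assumes "5 \<le> g"
  shows "nearly_full g 3 1 0 lo (g ^ 3)"
proof (rule nearly_full_residue)
  fix m
  assume "m \<le> g ^ 3" "m mod (g\<^sup>2 + 1) \<noteq> g\<^sup>2"
  moreover have "g ^ 3 < g * (g\<^sup>2 + 1)"
    using assms by (simp add: power2_eq_square power3_eq_cube)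
  ultimately show "weak_sum g 3 1 0 m"
    by (intro weak_sum_3_1_0) auto
next
  have "5 * g \<le> g\<^sup>2"
    using assms by (simp add: power2_eq_square)
  then show "\<not> g\<^sup>2 + 1 dvd g - 1" "\<not> g\<^sup>2 + 1 dvd (g - 1) + g ^ Suc 0 + 1"
    using assms by (auto dest!: dvd_imp_le)
qed (use assms in auto)

text \<open>Modulo \<open>g + 1\<close> the two differences are 2 and 4, and \<open>g + 1\<close>
  exceeds both.\<close>

lemma nearly_full_4_2_1:
  assumes "5 \<le> g"
  shows "nearly_full g 4 2 1 lo (g ^ 4)"
proof (rule nearly_full_residue)
  fix m
  assume "m \<le> g ^ 4" "m mod (g + 1) \<noteq> g"
  moreover have "g ^ 4 < g * (g ^ 3 + 1)"
    using assms by (simp add: eval_nat_numeral)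
  ultimately show "weak_sum g 4 2 1 m"
    by (intro weak_sum_4_2_1) auto
next
  obtain h where h: "g = h + 5"
    using assms by (metis le_add_diff_inverse2)
  show "g\<^sup>2 = g ^ 1 + (g - 1) * g"
    using h by (simp add: algebra_simps power2_eq_square)
  have small: "\<not> g + 1 dvd 2" "\<not> g + 1 dvd 4"
    using assms by (auto dest!: dvd_imp_le)
  have "(g - 1) * g = (g + 1) * (h + 3) + 2"
    using h by (simp add: algebra_simps)
  then show "\<not> g + 1 dvd (g - 1) * g"
    using small(1) dvd_add_right_iff[OF dvd_triv_left] by metis
  have "(g - 1) * g + g ^ Suc 1 + 1 = (g + 1) * (2 * h + 7) + 4"
    using h by (simp add: algebra_simps)
  then show "\<not> g + 1 dvd (g - 1) * g + g ^ Suc 1 + 1"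
    using small(2) dvd_add_right_iff[OF dvd_triv_left] by metis
qed (use assms in auto)

lemma full_3_2_1:
  assumes "2 \<le> g" "hi + 3 \<le> g ^ 3 + g\<^sup>2 + g"
  shows "full g 3 2 1 lo hi"
  using assms weak_sum_3_2_1 unfolding full_def by auto

section \<open>Induction on the lengths\<close>

text \<open>The interval is chosen to keep its shape when \<open>k\<close> grows by two;
  \<open>nearly_full\<close> in the premise suffices for \<open>full\<close> in the
  conclusion.\<close>

lemma full_P_step:
  assumes nf: "nearly_full g (k + 2) (k + 1) k (3 * g ^ k) (g ^ (k + 2) + 3 * g ^ k)"
    and "5 \<le> g"
  shows "full g (k + 4) (k + 3) (k + 2) (3 * g ^ (k + 2)) (g ^ (k + 4) + 3 * g ^ (k + 2))"
  unfolding full_def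
proof
  fix n
  assume n: "n \<in> {3 * g ^ (k + 2)..g ^ (k + 4) + 3 * g ^ (k + 2)}"
  \<comment> \<open>\<open>h\<close> here and \<open>w\<close> below encode \<open>5 \<le> g\<close>
    and \<open>g \<le> v\<close>, so that the bounds become polynomial inequalities without
    subtraction.\<close>
  obtain h where h: "g = h + 5"
    using assms(2) by (metis le_add_diff_inverse2)
  define v where "v = g ^ Suc k"
  have "g ^ 1 \<le> v"
    unfolding v_def using h by (intro power_increasing) auto
  then obtain w where w: "v = w + g"
    by (metis le_add_diff_inverse2 power_one_right)
  have v: "g ^ Suc (k + 2) = g * g * v" "g ^ Suc (k + 1) = g * v" "g * (3 * g ^ k) = 3 * v"
    "g * (g ^ (k + 2) + 3 * g ^ k) = g * g * v + 3 * v"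
    by (simp_all add: v_def algebra_simps)
  have n': "3 * (g * v) \<le> n" "n \<le> g * g * g * v + 3 * (g * v)"
    using n by (simp_all add: v_def algebra_simps eval_nat_numeral)
  obtain x y where "x < g" "y + 1 < g"
    "x * (g * g * v + 1) + (y + 1) * (g * v + 1) + ((g - 1) * (v + 1) + 3 * v) \<le> n"
    "n \<le> x * (g * g * v + 1) + y * (g * v + 1) + (g * g * v + 3 * v)"
  proof (rule two_staircases[where e = 0])
    show "0 * (g * g * v + 1) + (0 + 1) * (g * v + 1) + ((g - 1) * (v + 1) + 3 * v) \<le> n"
      using n'(1) h w by (simp add: algebra_simps)
    show "n \<le> (g - 1) * (g * g * v + 1) + (g - 2) * (g * v + 1) + (g * g * v + 3 * v)"
      using n'(2) h w by (simp add: algebra_simps)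
  qed (use h w in \<open>simp_all add: algebra_simps\<close>)
  then have "weak_sum g (Suc (Suc (k + 2))) (Suc (Suc (k + 1))) (Suc (Suc k)) n"
    by (intro weak_sum_nearly_full[OF nf]) (simp_all only: v v_def[symmetric] add.assoc)
  then show "weak_sum g (k + 4) (k + 3) (k + 2) n"
    by (simp add: eval_nat_numeral)
qed

text \<open>Steps of two need two starting points: \<open>k = 1\<close> is direct, and
  \<open>k = 2\<close> comes from the merely nearly full \<open>k = 0\<close>.\<close>

lemma full_P:
  assumes "5 \<le> g" "1 \<le> k"
  shows "full g (k + 2) (k + 1) k (3 * g ^ k) (g ^ (k + 2) + 3 * g ^ k)"
  using assms(2)
proof (induction k rule: less_induct)
  case (less k)
  obtain h where h: "g = h + 5"
    using assms(1) by (metis le_add_diff_inverse2)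
  consider "k = 1" | "k = 2" | j where "k = j + 2" "1 \<le> j"
    using less.prems by (metis One_nat_def Suc_1 add.commute add_2_eq_Suc' le_add_diff_inverse2
        not_less_eq_eq order_antisym_conv)
  then show ?case
  proof cases
    case 1
    have "g ^ 3 + 3 * g + 3 \<le> g ^ 3 + g\<^sup>2 + g"
      using h by (simp add: algebra_simps power2_eq_square)
    with 1 full_3_2_1[of g _ "3 * g"] assms(1) show ?thesis
      by (simp add: eval_nat_numeral)
  next
    case 2
    have "nearly_full g (0 + 2) (0 + 1) 0 (3 * g ^ 0) (g ^ (0 + 2) + 3 * g ^ 0)"
      using nearly_full_2_1_0[OF assms(1)] by (simp add: numeral_2_eq_2)
    from full_P_step[OF this assms(1)] show ?thesis
      by (simp add: 2 eval_nat_numeral)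
  next
    case 3
    from full_P_step[OF full_imp_nearly_full[OF less.IH] assms(1)] 3 show ?thesis
      by (simp add: eval_nat_numeral)
  qed
qed

text \<open>The step in \<open>x\<close> alone is as long as the window, but the range of
  \<open>y\<close> contributes about \<open>g ^ (k + 3)\<close> more, which closes the gaps.\<close>

lemma full_Q_step:
  assumes nf: "nearly_full g (k + 3) (k + 1) k (3 * g ^ k) (g ^ (k + 3))"
    and "5 \<le> g"
  shows "full g (k + 5) (k + 3) (k + 2) (3 * g ^ (k + 2)) (g ^ (k + 5))"
  unfolding full_def
proof
  fix n
  assume n: "n \<in> {3 * g ^ (k + 2)..g ^ (k + 5)}"
  obtain h where h: "g = h + 5"
    using assms(2) by (metis le_add_diff_inverse2)
  define v where "v = g ^ Suc k"
  have "g ^ 1 \<le> v"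
    unfolding v_def using h by (intro power_increasing) auto
  then obtain w where w: "v = w + g"
    by (metis le_add_diff_inverse2 power_one_right)
  have v: "g ^ Suc (k + 3) = g * g * g * v" "g ^ Suc (k + 1) = g * v" "g * (3 * g ^ k) = 3 * v"
    "g * g ^ (k + 3) = g * g * g * v"
    by (simp_all add: v_def algebra_simps eval_nat_numeral)
  have n': "3 * (g * v) \<le> n" "n \<le> g * g * g * g * v"
    using n by (simp_all add: v_def algebra_simps eval_nat_numeral)
  obtain x y where "x < g" "y + 1 < g"
    "x * (g * g * g * v + 1) + (y + 1) * (g * v + 1) + ((g - 1) * (v + 1) + 3 * v) \<le> n"
    "n \<le> x * (g * g * g * v + 1) + y * (g * v + 1) + g * g * g * v"
  proof (rule two_staircases[where e = 0])
    show "0 * (g * g * g * v + 1) + (0 + 1) * (g * v + 1) + ((g - 1) * (v + 1) + 3 * v) \<le> n"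
      using n'(1) h w by (simp add: algebra_simps)
    show "n \<le> (g - 1) * (g * g * g * v + 1) + (g - 2) * (g * v + 1) + g * g * g * v"
      using n'(2) h w by (simp add: algebra_simps)
  qed (use h w in \<open>simp_all add: algebra_simps\<close>)
  then have "weak_sum g (Suc (Suc (k + 3))) (Suc (Suc (k + 1))) (Suc (Suc k)) n"
    by (intro weak_sum_nearly_full[OF nf]) (simp_all only: v v_def[symmetric] add.assoc)
  then show "weak_sum g (k + 5) (k + 3) (k + 2) n"
    by (simp add: eval_nat_numeral)
qed

text \<open>Both starting values, \<open>k = 2\<close> and \<open>k = 3\<close>, arise by one step
  from nearly full ranges.\<close>

lemma full_Q:
  assumes "5 \<le> g" "2 \<le> k"
  shows "full g (k + 3) (k + 1) k (3 * g ^ k) (g ^ (k + 3))"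
  using assms(2)
proof (induction k rule: less_induct)
  case (less k)
  then obtain j where j: "k = j + 2"
    by (metis le_add_diff_inverse2)
  have "nearly_full g (j + 3) (j + 1) j (3 * g ^ j) (g ^ (j + 3))"
  proof -
    consider "j = 0" | "j = 1" | "2 \<le> j"
      by linarith
    then show ?thesis
    proof cases
      case 1
      then show ?thesis
        using nearly_full_3_1_0[OF assms(1)] by simp
    next
      case 2
      then show ?thesis
        using nearly_full_4_2_1[OF assms(1)] by (simp flip: One_nat_def)
    next
      case 3
      then show ?thesis
        using full_imp_nearly_full less.IH j by simp
    qed
  qed
  from full_Q_step[OF this assms(1)] show ?case
    by (simp add: j eval_nat_numeral)
qed

section \<open>The outermost digits\<close>

text \<open>The outermost step, with \<open>e = 1\<close> for nonzero leading digits;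
  \<open>lower\<close> is the expanded start of the window for \<open>x = y = 1\<close>. The upper
  end \<open>hi\<close> stays variable because one application needs a longer range than
  \<open>full_P\<close> gives.\<close>

lemma palindrome_sum_P:
  assumes base: "k = 0 \<and> nearly_full g (k + 2) (k + 1) k (3 * g ^ k) hi
      \<or> full g (k + 2) (k + 1) k (3 * g ^ k) hi"
    and g: "5 \<le> g" and hi: "g ^ (k + 2) + 3 * g ^ k \<le> hi"
    and lower: "g ^ (k + 3) + 2 * g ^ (k + 2) + (g + 2) * g ^ (k + 1) + g + 2 \<le> n"
    and upper: "n \<le> (g - 1) * (g ^ (k + 3) + 1) + (g - 2) * (g ^ (k + 2) + 1) + g * hi"
  shows "palindrome_sum g n"
proof -
  obtain h where h: "g = h + 5"
    using assms(2) by (metis le_add_diff_inverse2)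
  define v where "v = g ^ Suc k"
  have "g ^ 1 \<le> v"
    unfolding v_def using h by (intro power_increasing) auto
  then obtain w where w: "v = w + g"
    by (metis le_add_diff_inverse2 power_one_right)
  have v: "g ^ Suc (k + 2) = g * g * v" "g ^ Suc (k + 1) = g * v" "g * (3 * g ^ k) = 3 * v"
    by (simp_all add: v_def algebra_simps)
  have "g * (g ^ (k + 2) + 3 * g ^ k) \<le> g * hi"
    using hi by (rule mult_left_mono) simp
  then have "g * g * v + 3 * v \<le> g * hi"
    by (simp add: v_def algebra_simps)
  then obtain d where d: "g * hi = g * g * v + 3 * v + d"
    using le_Suc_ex by blast
  have n': "g * g * v + 2 * (g * v) + (g + 2) * v + g + 2 \<le> n"
    "n \<le> (g - 1) * (g * g * v + 1) + (g - 2) * (g * v + 1) + g * hi"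
    using lower upper by (simp_all add: v_def algebra_simps eval_nat_numeral)
  obtain x y where "1 \<le> x" "x < g" "1 \<le> y" "y + 1 < g"
    "x * (g * g * v + 1) + (y + 1) * (g * v + 1) + ((g - 1) * (v + 1) + 3 * v) \<le> n"
    "n \<le> x * (g * g * v + 1) + y * (g * v + 1) + g * hi"
  proof (rule two_staircases[where e = 1])
    show "1 * (g * g * v + 1) + (1 + 1) * (g * v + 1) + ((g - 1) * (v + 1) + 3 * v) \<le> n"
      using n'(1) h by (simp add: algebra_simps)
    show "n \<le> (g - 1) * (g * g * v + 1) + (g - 2) * (g * v + 1) + g * hi"
      by (fact n'(2))
  qed (unfold d, use h w in \<open>simp_all add: algebra_simps\<close>)
  then show ?thesis
    by (intro palindrome_sum_nearly_full[OF base]) (simp_all only: v v_def[symmetric] add.assoc)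
qed

text \<open>The single window for \<open>x = y = 1\<close> already covers the whole range.\<close>

lemma palindrome_sum_Q:
  assumes base: "k = 0 \<and> nearly_full g (k + 3) (k + 1) k (3 * g ^ k) (g ^ (k + 3))
      \<or> full g (k + 3) (k + 1) k (3 * g ^ k) (g ^ (k + 3))"
    and g: "5 \<le> g"
    and lower: "g ^ (k + 4) + 3 * g ^ (k + 2) + 3 * g ^ (k + 1) + 2 \<le> n"
    and upper: "n \<le> 2 * g ^ (k + 4)"
  shows "palindrome_sum g n"
proof -
  obtain h where h: "g = h + 5"
    using assms(2) by (metis le_add_diff_inverse2)
  define v where "v = g ^ Suc k"
  have "g ^ 1 \<le> v"
    unfolding v_def using h by (intro power_increasing) auto
  then have "g \<le> v"
    by simp
  have v: "g ^ Suc (k + 3) = g * g * g * v" "g ^ Suc (k + 1) = g * v" "g * (3 * g ^ k) = 3 * v"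
    "g * g ^ (k + 3) = g * g * g * v"
    by (simp_all add: v_def algebra_simps eval_nat_numeral)
  have n': "g * g * g * v + 3 * (g * v) + 3 * v + 2 \<le> n" "n \<le> 2 * (g * g * g * v)"
    using lower upper by (simp_all add: v_def algebra_simps eval_nat_numeral)
  show ?thesis
  proof (rule palindrome_sum_nearly_full[OF base, where x = 1 and y = 1])
    show "1 * (g ^ Suc (k + 3) + 1) + (1 + 1) * (g ^ Suc (k + 1) + 1) + (g - 1) * (g ^ Suc k + 1)
        + g * (3 * g ^ k) \<le> n"
      unfolding v v_def[symmetric] using n'(1) \<open>g \<le> v\<close> h by (simp add: algebra_simps)
    show "n \<le> 1 * (g ^ Suc (k + 3) + 1) + 1 * (g ^ Suc (k + 1) + 1) + g * g ^ (k + 3)"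
      unfolding v v_def[symmetric] using n'(2) by simp
  qed (use g in auto)
qed

text \<open>
  The outer digit \<open>z\<close> must be nonzero here and the remainders are only nearly full, so both members
  of a pair \<open>y, y + 1\<close> must have \<open>z \<noteq> 0\<close>. As \<open>z = n - 1 - y\<close> modulo \<open>g\<close>, one of the pairs \<open>1, 2\<close> and
  \<open>2, 3\<close> works unless \<open>n mod g = 3\<close>.
\<close>

lemma palindrome_sum_6_4_3:
  assumes g: "5 \<le> g" and mod3: "n mod g \<noteq> 3"
    and lower: "g ^ 5 + 4 * g ^ 3 \<le> n" and upper: "n \<le> 2 * g ^ 5"
  shows "palindrome_sum g n"
proof -
  obtain h where h: "g = h + 5"
    using g by (metis le_add_diff_inverse2)
  have *: "palindrome_sum g n" if y: "y = 1 \<or> y = 2" "n mod g \<noteq> y + 1" "n mod g \<noteq> y + 2" for y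
  proof -
    have dvd: "0 < g" "g dvd g ^ Suc 4" "g dvd g ^ Suc 2" "g dvd g ^ Suc 1"
      using g by auto
    \<comment> \<open>\<open>L = 0\<close> is possible because \<open>nearly_full_4_2_1\<close>
      holds with any lower end.\<close>
    have lo: "1 * (g ^ Suc 4 + 1) + (y + 1) * (g ^ Suc 2 + 1) + (g - 1) * (g ^ Suc 1 + 1) + 0 \<le> n"
    proof -
      have "(y + 1) * (g ^ Suc 2 + 1) \<le> 3 * (g ^ Suc 2 + 1)"
        using y(1) by (intro mult_right_mono) auto
      moreover have "1 * (g ^ Suc 4 + 1) + 3 * (g ^ Suc 2 + 1) + (g - 1) * (g ^ Suc 1 + 1) + 0 \<le> n"
        using lower h by (simp add: algebra_simps power_numeral_reduce)
      ultimately show ?thesis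
        by linarith
    qed
    have up: "n \<le> 1 * (g ^ Suc 4 + 1) + y * (g ^ Suc 2 + 1) + g * g ^ 4"
      using upper by (simp add: eval_nat_numeral)
    from two_outer_digits[OF dvd lo up] obtain z m z' m' where z: "z < g" "z' < g"
      "z = z' + 1 \<or> z = 0 \<and> z' + 1 = g"
      and n: "n = 1 * (g ^ Suc 4 + 1) + y * (g ^ Suc 2 + 1) + z * (g ^ Suc 1 + 1) + g * m"
        "n = 1 * (g ^ Suc 4 + 1) + (y + 1) * (g ^ Suc 2 + 1) + z' * (g ^ Suc 1 + 1) + g * m'"
      and m: "g * m \<le> g * g ^ 4" "g * m' \<le> g * g ^ 4" .
    have m: "m \<in> {0..g ^ 4}" "m' \<in> {0..g ^ 4}"
      using m g by auto
    have "0 < z"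
    proof (rule ccontr)
      assume "\<not> 0 < z"
      then have "n = (y + 1) + g * (g ^ 4 + y * g ^ 2 + m)"
        using n(1) by (simp add: algebra_simps power_numeral_reduce)
      then have "n mod g = (y + 1) mod g"
        by (metis mod_mult_self2)
      with y g show False
        by auto
    qed
    have "0 < z'"
    proof (rule ccontr)
      assume "\<not> 0 < z'"
      then have "n = (y + 2) + g * (g ^ 4 + (y + 1) * g ^ 2 + m')"
        using n(2) by (simp add: algebra_simps power_numeral_reduce)
      then have "n mod g = (y + 2) mod g"
        by (metis mod_mult_self2)
      with y g show False
        by auto
    qed
    from nearly_fullD[OF nearly_full_4_2_1[OF g] z(3) n m] show ?thesis
    proof
      assume "weak_sum g 4 2 1 m"
      from palindrome_sum_wrap[OF this _ _ _ _ _ z(1) n(1)] show ?thesis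
        using y(1) g \<open>0 < z\<close> by auto
    next
      assume "weak_sum g 4 2 1 m'"
      from palindrome_sum_wrap[OF this _ _ _ _ _ z(2) n(2)] show ?thesis
        using y(1) g \<open>0 < z'\<close> by auto
    qed
  qed
  show ?thesis
  proof (cases "n mod g = 2")
    case True
    then show ?thesis
      by (intro *[of 2]) auto
  next
    case False
    then show ?thesis
      using mod3 by (intro *[of 1]) auto
  qed
qed

section \<open>Two palindromes of equal length and a shorter one\<close>

lemma sum_of_two_digits:
  fixes g n :: nat
  assumes "n + 2 \<le> 2 * g"
  obtains a b where "a < g" "b < g" "n = a + b" "2 \<le> n \<Longrightarrow> 0 < a \<and> 0 < b"
  \<comment> \<open>The first digit is as large as possible, but capped at \<open>n - 1\<close> so
    that the second stays positive.\<close>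
  using assms by (intro that[of "min (n - 1) (g - 1)" "n - min (n - 1) (g - 1)"]) auto

text \<open>Two palindromes of length 5 add without carries as one palindrome whose digits range up
  to \<open>2 * g - 2\<close>. Here \<open>x\<close>, \<open>x'\<close> and \<open>r div g\<close>
  are its outer, second and middle digits; \<open>z\<close> and \<open>r mod g\<close> are the
  digits of the length-3 summand.\<close>

lemma palindrome_sum_5_5_3:
  assumes g: "5 \<le> g" and "2 \<le> x" "x + 2 \<le> 2 * g" "0 < z" "z < g" "m \<le> 2 * g ^ 3"
    and n: "n = x * (g ^ 4 + 1) + z * (g\<^sup>2 + 1) + g * m"
  shows "palindrome_sum g n"
proof -
  obtain h where h: "g = h + 5"
    using g by (metis le_add_diff_inverse2)
  have "\<exists>x' r. m = x' * (g\<^sup>2 + 1) + r \<and> x' + 2 \<le> 2 * g \<and> r < g * (2 * h + 9)"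
  proof (cases "m < (2 * h + 9) * (g\<^sup>2 + 1)")
    case True
    have "m = m div (g\<^sup>2 + 1) * (g\<^sup>2 + 1) + m mod (g\<^sup>2 + 1)"
      by (simp only: div_mult_mod_eq)
    moreover have "m div (g\<^sup>2 + 1) < 2 * h + 9"
      using True by (rule less_mult_imp_div_less)
    then have "m div (g\<^sup>2 + 1) + 2 \<le> 2 * g"
      using h by linarith
    moreover have "m mod (g\<^sup>2 + 1) < g\<^sup>2 + 1"
      by (intro mod_less_divisor) simp
    moreover have "g\<^sup>2 + 1 \<le> g * (2 * h + 9)"
      using h by (simp add: algebra_simps power2_eq_square)
    ultimately show ?thesis
      by (meson less_le_trans)
  next
    case False
    \<comment> \<open>\<open>2 * h + 8\<close> is \<open>2 * g - 2\<close>, the largest sum of two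
      digits.\<close>
    define r where "r = m - (2 * h + 8) * (g\<^sup>2 + 1)"
    have "(2 * h + 8) * (g\<^sup>2 + 1) \<le> (2 * h + 9) * (g\<^sup>2 + 1)"
      by (intro mult_right_mono) auto
    with False have "m = (2 * h + 8) * (g\<^sup>2 + 1) + r"
      unfolding r_def by linarith
    moreover from this have "r < g * (2 * h + 9)"
      using assms(6) h by (simp add: algebra_simps power2_eq_square power3_eq_cube)
    moreover have "(2 * h + 8) + 2 \<le> 2 * g"
      using h by simp
    ultimately show ?thesis
      by blast
  qed
  then obtain x' r where r: "m = x' * (g\<^sup>2 + 1) + r" "x' + 2 \<le> 2 * g" "r < g * (2 * h + 9)"
    by blast
  have "r div g < 2 * h + 9"
    using r(3) by (intro less_mult_imp_div_less) (simp add: mult.commute)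
  then have "r div g + 2 \<le> 2 * g"
    using h by simp
  then obtain y\<^sub>1 y\<^sub>2 where y: "y\<^sub>1 < g" "y\<^sub>2 < g" "r div g = y\<^sub>1 + y\<^sub>2"
    using sum_of_two_digits by blast
  obtain x\<^sub>1' x\<^sub>2' where x': "x\<^sub>1' < g" "x\<^sub>2' < g" "x' = x\<^sub>1' + x\<^sub>2'"
    using sum_of_two_digits[OF r(2)] by blast
  obtain x\<^sub>1 x\<^sub>2 where x: "x\<^sub>1 < g" "x\<^sub>2 < g" "x = x\<^sub>1 + x\<^sub>2" "0 < x\<^sub>1" "0 < x\<^sub>2"
    using sum_of_two_digits[OF assms(3)] assms(2) by metis
  define d where "d = r mod g"
  have d: "d < g" "r = g * (y\<^sub>1 + y\<^sub>2) + d"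
    using g by (auto simp: d_def simp flip: y(3))
  show ?thesis
  proof (rule palindrome_sumI)
    show "base_palindrome g (x\<^sub>1 * (g ^ Suc 3 + 1) + g * (x\<^sub>1' * (g ^ 2 + 1) + g * y\<^sub>1))"
      using x x' y by (intro base_palindrome_wrap weak_palindrome_3)
    show "base_palindrome g (x\<^sub>2 * (g ^ Suc 3 + 1) + g * (x\<^sub>2' * (g ^ 2 + 1) + g * y\<^sub>2))"
      using x x' y by (intro base_palindrome_wrap weak_palindrome_3)
    show "base_palindrome g (z * (g ^ Suc 1 + 1) + g * d)"
      using assms d by (intro base_palindrome_wrap) auto
    show "n = x\<^sub>1 * (g ^ Suc 3 + 1) + g * (x\<^sub>1' * (g ^ 2 + 1) + g * y\<^sub>1)
      + (x\<^sub>2 * (g ^ Suc 3 + 1) + g * (x\<^sub>2' * (g ^ 2 + 1) + g * y\<^sub>2)) + (z * (g ^ Suc 1 + 1) + g * d)"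
      by (simp add: n r(1) x(3) x'(3) d(2) algebra_simps power_numeral_reduce)
  qed
qed

text \<open>The residue 3 requires \<open>x + z\<close> to be 3 modulo \<open>g\<close>. The pairs
  \<open>(g, 3)\<close> and \<open>(g + 2, 1)\<close> together cover the range, as each leaves room
  for \<open>m\<close> up to \<open>2 * g^3\<close>.\<close>

lemma palindrome_sum_5_5_3_residue:
  assumes g: "5 \<le> g" and mod3: "n mod g = 3"
    and lower: "g ^ 5 + 4 * g ^ 3 \<le> n" and upper: "n \<le> g ^ 5 + 4 * g ^ 4"
  shows "palindrome_sum g n"
proof -
  obtain h where h: "g = h + 5"
    using g by (metis le_add_diff_inverse2)
  have "0 < g"
    using g by simp
  define q where "q = n div g"
  have n: "n = g * q + 3"
    unfolding q_def using mult_div_mod_eq[of g n] mod3 by simp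
  show ?thesis
  proof (cases "n \<le> g ^ 5 + 2 * g ^ 4 + 3 * g\<^sup>2 + g + 3")
    case True
    have "g * (g ^ 4 + 1 + 3 * g) \<le> g * q"
      using lower n h by (simp add: algebra_simps power_numeral_reduce)
    then have "g ^ 4 + 1 + 3 * g \<le> q"
      using \<open>0 < g\<close> by (simp only: nat_mult_le_cancel1)
    then obtain m where m: "q = g ^ 4 + 1 + 3 * g + m"
      using le_Suc_ex by blast
    have "g * m \<le> g * (2 * g ^ 3)"
      using True by (simp add: n m algebra_simps power_numeral_reduce)
    then have "m \<le> 2 * g ^ 3"
      using \<open>0 < g\<close> by (simp only: nat_mult_le_cancel1)
    then show ?thesis
      using g by (intro palindrome_sum_5_5_3[of g g 3 m])
        (auto simp: n m algebra_simps power_numeral_reduce)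
  next
    case False
    have "g * (g ^ 4 + 2 * g ^ 3 + g + 1) \<le> g * q"
      using False n h by (simp add: algebra_simps power_numeral_reduce)
    then have "g ^ 4 + 2 * g ^ 3 + g + 1 \<le> q"
      using \<open>0 < g\<close> by (simp only: nat_mult_le_cancel1)
    then obtain m where m: "q = g ^ 4 + 2 * g ^ 3 + g + 1 + m"
      using le_Suc_ex by blast
    have "n = g ^ 5 + 2 * g ^ 4 + g\<^sup>2 + g + 3 + g * m" "2 * g ^ 4 = g * (2 * g ^ 3)"
      by (simp_all add: n m algebra_simps power_numeral_reduce)
    with upper have "g * m \<le> g * (2 * g ^ 3)"
      by linarith
    then have "m \<le> 2 * g ^ 3"
      using \<open>0 < g\<close> by (simp only: nat_mult_le_cancel1)
    then show ?thesis
      using g by (intro palindrome_sum_5_5_3[of g "g + 2" 1 m])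
        (auto simp: n m algebra_simps power_numeral_reduce)
  qed
qed

section \<open>Small numbers\<close>

lemma palindrome_sum_two_digits:
  assumes "2 \<le> g" "n < g * (g + 1)"
  shows "palindrome_sum g n"
proof -
  define j where "j = n div (g + 1)"
  have "j < g"
    unfolding j_def using assms(2) by (rule less_mult_imp_div_less)
  have n: "n = j * (g + 1) + n mod (g + 1)"
    unfolding j_def by (simp only: div_mult_mod_eq)
  have less: "n mod (g + 1) < g + 1"
    by (intro mod_less_divisor) simp
  show ?thesis
  proof (cases "n mod (g + 1) = g")
    case True
    then show ?thesis
      using assms(1) \<open>j < g\<close> n
      by (intro palindrome_sumI[OF base_palindrome_two_digits[of j] base_palindrome_digit[of "g - 1"]
            base_palindrome_digit[of 1]]) auto
  next
    case False
    then show ?thesis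
      using assms(1) \<open>j < g\<close> n less
      by (intro palindrome_sumI[OF base_palindrome_two_digits[of j]
            base_palindrome_digit[of "n mod (g + 1)"] base_palindrome_digit[of 0]]) linarith+
  qed
qed

lemma palindrome_sum_three_digits:
  assumes "2 \<le> g" "g\<^sup>2 < n" "n + 3 \<le> g ^ 3 + g\<^sup>2 + g"
  shows "palindrome_sum g n"
proof -
  obtain x a y z where *: "x < g" "a < g" "y < g" "z < g" "0 < x"
    "n = x * (g\<^sup>2 + 1) + g * a + y * (g + 1) + z"
    using digits_of_lengths_3_2_1[OF assms(1,3)] assms(2) by blast
  then have "base_palindrome g (x * (g ^ Suc 1 + 1) + g * a)"
    by (intro base_palindrome_wrap) auto
  with * show ?thesis
    by (intro palindrome_sumI[OF _ base_palindrome_two_digits[of y] base_palindrome_digit[of z]])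
      (auto simp: power2_eq_square)
qed

text \<open>Lengths 4, 3, 1 with leading digit 1: \<open>a\<close> combines the inner digit of
  length 4 (quotient by \<open>g + 1\<close>) with the middle digit of length 3 (remainder). Only
  remainder \<open>g\<close> fails, and increasing \<open>y\<close> then shifts \<open>a\<close>
  away from it.\<close>

lemma palindrome_sum_four_digits:
  assumes g: "5 \<le> g" and "g ^ 3 + g\<^sup>2 + 2 \<le> n" "n < 2 * g ^ 3"
  shows "palindrome_sum g n"
proof -
  obtain h where h: "g = h + 5"
    using g by (metis le_add_diff_inverse2)
  have hit: "palindrome_sum g n" if "0 < y" "y < g" "a < g * (g + 1)" "a mod (g + 1) \<noteq> g" "z < g"
    "n = (g ^ 3 + 1) + y * (g\<^sup>2 + 1) + g * a + z" for y a z
  proof (rule palindrome_sumI)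
    have "a div (g + 1) < g"
      using that(3) by (rule less_mult_imp_div_less)
    then show "base_palindrome g (1 * (g ^ Suc 2 + 1) + g * (a div (g + 1) * (g + 1)))"
      using g by (intro base_palindrome_wrap weak_palindrome_2) auto
    have "a mod (g + 1) < g + 1"
      by (intro mod_less_divisor) simp
    then have "a mod (g + 1) < g"
      using that(4) by linarith
    then show "base_palindrome g (y * (g ^ Suc 1 + 1) + g * (a mod (g + 1)))"
      using that by (intro base_palindrome_wrap) auto
    show "base_palindrome g z"
      using that by (intro base_palindrome_digit)
    have "g * a = g * (a div (g + 1) * (g + 1)) + g * (a mod (g + 1))"
      by (simp only: distrib_left[symmetric] div_mult_mod_eq)
    then show "n = 1 * (g ^ Suc 2 + 1) + g * (a div (g + 1) * (g + 1))
        + (y * (g ^ Suc 1 + 1) + g * (a mod (g + 1))) + z"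
      unfolding that(6) by (simp add: power2_eq_square power3_eq_cube)
  qed
  define s where "s = n - (g ^ 3 + g\<^sup>2 + 2)"
  define q z where "q = s div g" and "z = s mod g"
  have "z < g"
    using g by (simp add: z_def)
  have n: "n = g ^ 3 + g\<^sup>2 + 2 + (g * q + z)"
    using assms(2) by (simp add: q_def z_def s_def)
  with assms(3) have "g * q < g ^ 3"
    by linarith
  then have "g * q < g * (g * g)"
    by (simp only: power3_eq_cube mult.assoc)
  then have "q < g * g"
    by simp
  show ?thesis
  proof (cases "q mod (g + 1) = g")
    case False
    then show ?thesis
      using \<open>z < g\<close> \<open>q < g * g\<close> n g by (intro hit[of 1 q z]) auto
  next
    case True
    define j where "j = q div (g + 1)"
    have q: "q = j * (g + 1) + g"
      unfolding j_def using div_mult_mod_eq[of q "g + 1"] True by simp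
    have mod0: "i * (g + 1) mod (g + 1) \<noteq> g" for i
      using g by (simp only: mod_mult_self2_is_0)
    \<comment> \<open>Raising \<open>y\<close> by one costs \<open>g\<close> in \<open>a\<close> and
      1 in \<open>z\<close>. With \<open>z = 0\<close> a borrow is needed, so \<open>y\<close>
      becomes 3 and \<open>z\<close> becomes \<open>g - 2\<close>; this takes one unit from
      \<open>j\<close>.\<close>
    consider i where "z = i + 1" | i where "z = 0" "j = i + 1" | "z = 0" "j = 0"
      by (metis Suc_eq_plus1 not0_implies_Suc)
    then show ?thesis
    proof cases
      case 1
      then show ?thesis
        using mod0[of j] \<open>z < g\<close> \<open>q < g * g\<close> n g q
        by (intro hit[of 2 "j * (g + 1)" i]) (auto simp: algebra_simps power2_eq_square)
    next
      case 2
      then show ?thesis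
        using mod0[of i] \<open>q < g * g\<close> n h q
        by (intro hit[of 3 "i * (g + 1)" "g - 2"]) (auto simp: algebra_simps power2_eq_square)
    next
      case 3
      \<comment> \<open>The only number left is \<open>g^3 + 2 * g^2 + 2\<close>, the sum of the
        palindrome with digits 1111, \<open>(g - 2) * (g + 1)\<close> and 3.\<close>
      have "base_palindrome g (1 * (g ^ Suc 2 + 1) + g * (1 * (g + 1)))"
        using g by (intro base_palindrome_wrap weak_palindrome_2) auto
      with 3 n q h show ?thesis
        by (intro palindrome_sumI[OF _ base_palindrome_two_digits[of "h + 3"]
              base_palindrome_digit[of 3]]) (auto simp: algebra_simps power2_eq_square power3_eq_cube)
    qed
  qed
qed

section \<open>Large numbers\<close>

text \<open>\<open>k = 1\<close> is excluded because lengths (4, 2, 1) are only known to be nearly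
  full while their last length is not 0.\<close>

lemma palindrome_sum_generic:
  assumes g: "5 \<le> g" and k: "k \<noteq> 1" and n: "2 * g ^ (k + 3) \<le> n" "n \<le> 2 * g ^ (k + 4)"
  shows "palindrome_sum g n"
proof -
  obtain h where h: "g = h + 5"
    using g by (metis le_add_diff_inverse2)
  have P: "k = 0 \<and> nearly_full g (k + 2) (k + 1) k (3 * g ^ k) (g ^ (k + 2) + 3 * g ^ k)
      \<or> full g (k + 2) (k + 1) k (3 * g ^ k) (g ^ (k + 2) + 3 * g ^ k)"
    using full_P[OF g, of k] nearly_full_2_1_0[OF g] by (cases "k = 0") (auto simp: numeral_2_eq_2)
  have Q: "k = 0 \<and> nearly_full g (k + 3) (k + 1) k (3 * g ^ k) (g ^ (k + 3))
      \<or> full g (k + 3) (k + 1) k (3 * g ^ k) (g ^ (k + 3))"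
    using full_Q[OF g, of k] nearly_full_3_1_0[OF g] k by (cases "k = 0") auto
  define v where "v = g ^ Suc k"
  have "g ^ 1 \<le> v"
    unfolding v_def using h by (intro power_increasing) auto
  then obtain w where w: "v = w + g"
    by (metis le_add_diff_inverse2 power_one_right)
  have v: "g ^ (k + 1) = v" "g ^ (k + 2) = g * v" "g ^ (k + 3) = g * g * v"
    "g ^ (k + 4) = g * g * g * v" "g * (g * v + 3 * g ^ k) = g * g * v + 3 * v"
    by (simp_all add: v_def algebra_simps eval_nat_numeral)
  show ?thesis
  proof (cases "n \<le> g * g * g * v + 3 * (g * v) + 3 * v + 2")
    case True
    show ?thesis
    proof (rule palindrome_sum_P[OF P g order_refl])
      show "g ^ (k + 3) + 2 * g ^ (k + 2) + (g + 2) * g ^ (k + 1) + g + 2 \<le> n"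
        using n(1) h w unfolding v by (simp add: algebra_simps)
      show "n \<le> (g - 1) * (g ^ (k + 3) + 1) + (g - 2) * (g ^ (k + 2) + 1)
          + g * (g ^ (k + 2) + 3 * g ^ k)"
        using True h w unfolding v by (simp add: algebra_simps)
    qed
  next
    case False
    then show ?thesis
      using n(2) by (intro palindrome_sum_Q[OF Q g]) (simp_all only: v)
  qed
qed

lemma palindrome_sum_middle:
  assumes g: "5 \<le> g" and n: "2 * g ^ 4 \<le> n" "n \<le> 2 * g ^ 5"
  shows "palindrome_sum g n"
proof -
  obtain h where h: "g = h + 5"
    using g by (metis le_add_diff_inverse2)
  consider "n \<le> g ^ 5 + 4 * g ^ 3" | "g ^ 5 + 4 * g ^ 3 \<le> n" "n mod g \<noteq> 3"
    | "g ^ 5 + 4 * g ^ 3 \<le> n" "n mod g = 3" "n \<le> g ^ 5 + 4 * g ^ 4"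
    | "g ^ 5 + 4 * g ^ 4 \<le> n"
    by linarith
  then show ?thesis
  proof cases
    case 1
    \<comment> \<open>The end \<open>g^3 + 3 * g\<close> from \<open>full_P\<close> would fall short
      of \<open>g^5 + 4 * g^3\<close> when \<open>g = 5\<close>; \<open>g^3 + g^2\<close>
      suffices.\<close>
    have "full g (1 + 2) (1 + 1) 1 (3 * g ^ 1) (g ^ 3 + g\<^sup>2)"
      using full_3_2_1[of g "g ^ 3 + g\<^sup>2"] g by (simp add: eval_nat_numeral)
    then show ?thesis
    proof (rule palindrome_sum_P[OF disjI2 g])
      show "g ^ (1 + 2) + 3 * g ^ 1 \<le> g ^ 3 + g\<^sup>2"
        using h by (simp add: algebra_simps power_numeral_reduce)
      show "g ^ (1 + 3) + 2 * g ^ (1 + 2) + (g + 2) * g ^ (1 + 1) + g + 2 \<le> n"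
        using n(1) h by (simp add: algebra_simps power_numeral_reduce)
      show "n \<le> (g - 1) * (g ^ (1 + 3) + 1) + (g - 2) * (g ^ (1 + 2) + 1) + g * (g ^ 3 + g\<^sup>2)"
        using 1 h by (simp add: algebra_simps power_numeral_reduce)
    qed
  next
    case 2
    then show ?thesis
      using palindrome_sum_6_4_3 g n(2) by blast
  next
    case 3
    then show ?thesis
      using palindrome_sum_5_5_3_residue g by blast
  next
    case 4
    show ?thesis
    proof (rule palindrome_sum_P[OF disjI2[OF full_P[OF g, of 2]] g order_refl])
      show "g ^ (2 + 3) + 2 * g ^ (2 + 2) + (g + 2) * g ^ (2 + 1) + g + 2 \<le> n"
        using 4 h by (simp add: algebra_simps power_numeral_reduce)
      show "n \<le> (g - 1) * (g ^ (2 + 3) + 1) + (g - 2) * (g ^ (2 + 2) + 1)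
          + g * (g ^ (2 + 2) + 3 * g ^ 2)"
        using n(2) h by (simp add: algebra_simps power_numeral_reduce)
    qed simp
  qed
qed

lemma palindrome_sum_all:
  assumes g: "5 \<le> g"
  shows "palindrome_sum g n"
proof -
  obtain h where h: "g = h + 5"
    using g by (metis le_add_diff_inverse2)
  consider "n < g * (g + 1)" | "g * (g + 1) \<le> n" "n + 3 \<le> g ^ 3 + g\<^sup>2 + g"
    | "g ^ 3 + g\<^sup>2 + g < n + 3" "n < 2 * g ^ 3" | "2 * g ^ 3 \<le> n"
    by linarith
  then show ?thesis
  proof cases
    case 1
    then show ?thesis
      using palindrome_sum_two_digits g by simp
  next
    case 2
    then show ?thesis
      using palindrome_sum_three_digits g by (simp add: power2_eq_square)
  next
    case 3
    then show ?thesis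
      using palindrome_sum_four_digits g by simp
  next
    case 4
    \<comment> \<open>The ranges to be matched run from \<open>2 * g ^ i\<close> to
      \<open>2 * g ^ (i + 1)\<close>, so the power of \<open>g\<close> is located relative to
      \<open>n div 2\<close>.\<close>
    then have "g ^ 3 \<le> n div 2"
      by simp
    moreover have "1 \<le> g ^ 3"
      using g by (intro one_le_power) simp
    then have "1 \<le> n div 2"
      using calculation by linarith
    ultimately obtain i where i: "g ^ i \<le> n div 2" "n div 2 < g ^ (i + 1)"
      using ex_power_ivl1[of g "n div 2"] g by auto
    have "g ^ 3 < g ^ (i + 1)"
      using \<open>g ^ 3 \<le> n div 2\<close> i(2) by (rule le_less_trans)
    then have "3 < i + 1"
      using g by (intro power_less_imp_less_exp[of g 3]) auto
    then obtain k where "i = k + 3"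
      by (metis le_add_diff_inverse2 less_Suc_eq_le Suc_eq_plus1)
    with i have "g ^ (k + 3) \<le> n div 2" "n div 2 < g ^ (k + 4)"
      by (simp_all add: ac_simps)
    then have "2 * g ^ (k + 3) \<le> n" "n \<le> 2 * g ^ (k + 4)"
      by linarith+
    then show ?thesis
      using palindrome_sum_generic[OF g] palindrome_sum_middle[OF g]
      by (cases "k = 1") (auto simp: eval_nat_numeral)
  qed
qed

theorem theorem1p1:
  fixes g n :: nat
  assumes "g \<ge> 5" and "n > 0"
  shows "\<exists>a b c. base_palindrome g a \<and> base_palindrome g b \<and> base_palindrome g c
           \<and> n = a + b + c"
  using palindrome_sum_all[OF assms(1)] unfolding palindrome_sum_def .

end
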